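(* Let $j\in\mathbb{Z}$ and $x>0$. For every $f\in E\cap C[0,+\infty)$, $$\lim_{n\rightarrow\infty}\left(S_{n,j}f\right)(x)=f(x).$$
   Context: For $A\ge 0$, $E_A$ denotes the space of locally integrable functions $f:[0,\infty)\to\mathbb{R}$ satisfying $|f(t)|\le Ke^{At}$ for all $t\ge 0$, for some constant $K>0$; and $E:=\bigcup_{A\ge 0}E_A$. $C[0,+\infty)$ is the space of continuous real-valued functions on $[0,\infty)$. Put $s_{n,k}(x)=\frac{(nx)^k}{k!}e^{-nx}$ for integers $k\ge 0$ and $s_{n,k}(x)=0$ for $k<0$. For $j\in\mathbb{Z}$, $f\in E_A$ and positive integers $n>A$, the operator $S_{n,j}$ is defined for $x\ge0$ by $$(S_{n,j}f)(x)=f(0)\sum_{k=0}^{j-1}s_{n,k}(x)+\sum_{k=j}^{\infty}s_{n,k}(x)\,n\int_0^\infty s_{n,k-j}(t)f(t)\,dt.$$ A sum is zero if its upper limit is smaller than its lower limit. *)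

theory Defs
  imports "HOL-Analysis.Analysis"
begin

(* Functions on [0,\<infinity>) are represented by functions of type real \<Rightarrow> real of which only the
   values on {0..} are constrained and used. Local integrability is meant in the Lebesgue
   sense: absolutely_integrable_on is set_integrable with respect to lebesgue. *)
definition E_exp :: "real \<Rightarrow> (real \<Rightarrow> real) set" where
  "E_exp A = {f. (\<forall>b\<ge>0. f absolutely_integrable_on {0..b}) \<and>
                 (\<exists>K>0. \<forall>t\<ge>0. \<bar>f t\<bar> \<le> K * exp (A * t))}"

definition E_space :: "(real \<Rightarrow> real) set" where
  "E_space = (\<Union>A\<in>{0..}. E_exp A)"

definition C_space :: "(real \<Rightarrow> real) set" where
  "C_space = {f. continuous_on {0..} f}"

definition szasz_basis :: "nat \<Rightarrow> int \<Rightarrow> real \<Rightarrow> real" where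
  "szasz_basis n k x =
     (if k < 0 then 0 else (real n * x) ^ nat k / fact (nat k) * exp (- (real n * x)))"

(* The series over the integers k \<ge> j is written as an ordinary series over i via k = j + i.
   The interval {0..j - 1} of integers is empty for j \<le> 0.
   The value is meaningful for f in E_exp A, n > A and x \<ge> 0: then all integrals exist and
   the series converges absolutely. *)
definition szasz_durrmeyer :: "nat \<Rightarrow> int \<Rightarrow> (real \<Rightarrow> real) \<Rightarrow> real \<Rightarrow> real" where
  "szasz_durrmeyer n j f x =
     f 0 * (\<Sum>k\<in>{0..j - 1}. szasz_basis n k x) +
     (\<Sum>i. let k = j + int i in
        szasz_basis n k x *
        (real n * (LINT t:{0..}|lebesgue. szasz_basis n (k - j) t * f t)))"

end

theory Submission
  imports Defs "HOL-Probability.Distributions" "HOL-Real_Asymp.Real_Asymp"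
begin

text \<open>
  The proof is a Korovkin argument with exponential functions as test functions. They suit the
  operator because both of its ingredients act on them explicitly. The kernel
  \<open>n * szasz_basis n i t\<close> is the density of the Erlang distribution with shape \<open>i + 1\<close> and rate
  \<open>n\<close>, and multiplying it by \<open>exp (c * t)\<close> only changes the rate to \<open>n - c\<close>; hence its
  exponential moments are powers of \<open>\<rho> = n / (n - c)\<close> (\<open>erlang_exp_moment\<close>). Summing these powers
  against the Poisson weights \<open>szasz_basis n k x\<close> gives an exponential series, again in closed
  form (\<open>szasz_basis_power_sums\<close>), up to the finitely many weights with \<open>k < j\<close>, each of which
  tends to \<open>0\<close> for \<open>x > 0\<close>. Since \<open>\<rho>\<close> tends to \<open>1\<close> and \<open>n * (\<rho> - 1)\<close> to \<open>c\<close>, the operator maps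
  \<open>exp (c * t)\<close> to something that converges to \<open>exp (c * x)\<close> (\<open>szasz_exp_sum_tendsto\<close>).

  To pass to a general \<open>f\<close> with \<open>\<bar>f t\<bar> \<le> K * exp (A * t)\<close>, put \<open>B = A + 1\<close> and
  \<open>v = exp (B * x)\<close>. The function \<open>(exp (B * t) - v)\<^sup>2\<close> is a combination of three test functions
  that vanishes only at \<open>x\<close> and outgrows \<open>f\<close>, so
  \<open>\<bar>f t - f x\<bar> \<le> \<epsilon> + M * (exp (B * t) - v)\<^sup>2\<close> for every \<open>\<epsilon> > 0\<close> and a suitable \<open>M\<close>
  (\<open>deviation_le_exp_square\<close>). The operator preserves this inequality, and there the \<open>M\<close> term
  tends to the value \<open>0\<close> of the square at \<open>x\<close>.
\<close>

section \<open>Exponential moments of the Durrmeyer means\<close>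

definition erlang_mean :: "nat \<Rightarrow> real \<Rightarrow> (real \<Rightarrow> real) \<Rightarrow> real" where
  "erlang_mean i l f = (\<integral>t. erlang_density i l t * f t \<partial>lebesgue)"

lemma has_bochner_integral_erlang_density:
  assumes "l > 0"
  shows "has_bochner_integral lborel (erlang_density i l) 1"
proof (rule has_bochner_integral_nn_integral)
  interpret prob_space "density lborel (erlang_density i l)"
    using assms by (rule prob_space_erlang_density)
  show "(\<integral>\<^sup>+ t. ennreal (erlang_density i l t) \<partial>lborel) = ennreal 1"
    using emeasure_space_1 by (simp add: emeasure_density)
qed (use assms in auto)

text \<open>
  The exponential factor is absorbed into the rate; the power compensates for the different
  normalising constants \<open>l ^ Suc i\<close> and \<open>(l - c) ^ Suc i\<close> of the two densities.
\<close>

lemma erlang_density_exp_tilt: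
  assumes "c < l"
  shows "erlang_density i l t * exp (c * t) = (l / (l - c)) ^ Suc i * erlang_density i (l - c) t"
proof (cases "t < 0")
  case False
  have "exp (- l * t) * exp (c * t) = exp (- (l - c) * t)"
    by (simp add: exp_add [symmetric] algebra_simps)
  then show ?thesis
    using assms False by (simp add: erlang_density_def power_divide del: power_Suc)
qed (simp add: erlang_density_def)

lemma erlang_exp_moment:
  assumes "c < l" "0 < l"
  shows "has_bochner_integral lebesgue (\<lambda>t. erlang_density i l t * exp (c * t))
           ((l / (l - c)) ^ Suc i)"
proof -
  have "has_bochner_integral lborel (\<lambda>t. (l / (l - c)) ^ Suc i * erlang_density i (l - c) t)
          ((l / (l - c)) ^ Suc i * 1)"
    using assms by (intro has_bochner_integral_mult_right has_bochner_integral_erlang_density) auto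
  then show ?thesis
    unfolding erlang_density_exp_tilt [OF assms(1)]
    by (simp add: has_bochner_integral_iff integrable_completion integral_completion)
qed

text \<open>
  Apart from the boundary term, the operator is a Poisson mixture of Erlang means, so that its
  estimates reduce to integrals against probability densities.
\<close>

lemma szasz_durrmeyer_eq_erlang_mean:
  assumes "n > 0"
  shows "szasz_durrmeyer n j f x =
           f 0 * (\<Sum>k\<in>{0..j - 1}. szasz_basis n k x) +
           (\<Sum>i. szasz_basis n (j + int i) x * erlang_mean i (real n) f)"
proof -
  have "real n * (LINT t:{0..}|lebesgue. szasz_basis n (int i) t * f t) = erlang_mean i (real n) f"
    for i
    unfolding erlang_mean_def set_lebesgue_integral_def
    using assms
    by (subst integral_mult_right_zero [symmetric], intro Bochner_Integration.integral_cong)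
      (auto simp: erlang_density_def szasz_basis_def power_mult_distrib indicator_def field_simps)
  then show ?thesis
    by (simp add: szasz_durrmeyer_def Let_def)
qed

text \<open>
  The Erlang density vanishes on negative arguments, so a function given only on \<open>{0..}\<close> may be
  integrated over the whole line.
\<close>

lemma integrable_erlang_times:
  assumes f: "continuous_on {0..} f" and bound: "\<And>t. t \<ge> 0 \<Longrightarrow> \<bar>f t\<bar> \<le> K * exp (A * t)"
    and "A < l" "0 < l"
  shows "integrable lebesgue (\<lambda>t. erlang_density i l t * f t)"
proof (rule Bochner_Integration.integrable_bound)
  show "integrable lebesgue (\<lambda>t. K * (erlang_density i l t * exp (A * t)))"
    using erlang_exp_moment [OF assms(3,4)] by (auto simp: has_bochner_integral_iff)
  have "f \<in> borel_measurable (lebesgue_on {0..})"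
    by (rule continuous_imp_measurable_on_sets_lebesgue [OF f]) auto
  then have "(\<lambda>t. indicator {0..} t *\<^sub>R f t) \<in> borel_measurable lebesgue"
    by (subst (asm) borel_measurable_restrict_space_iff) auto
  then have "(\<lambda>t. erlang_density i l t * (indicator {0..} t *\<^sub>R f t)) \<in> borel_measurable lebesgue"
    by (intro borel_measurable_times measurable_completion [of "erlang_density i l"]) auto
  also have "(\<lambda>t. erlang_density i l t * (indicator {0..} t *\<^sub>R f t)) =
             (\<lambda>t. erlang_density i l t * f t)"
    by (auto simp: erlang_density_def indicator_def)
  finally show "(\<lambda>t. erlang_density i l t * f t) \<in> borel_measurable lebesgue" .
  have "\<bar>erlang_density i l t * f t\<bar> \<le> \<bar>K * (erlang_density i l t * exp (A * t))\<bar>" for t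
  proof (cases "t < 0")
    case False
    have "\<bar>erlang_density i l t * f t\<bar> = erlang_density i l t * \<bar>f t\<bar>"
      using assms by (simp add: abs_mult)
    also have "\<dots> \<le> erlang_density i l t * (K * exp (A * t))"
      using bound [of t] False assms by (intro mult_left_mono) auto
    also have "\<dots> = K * (erlang_density i l t * exp (A * t))"
      by simp
    finally show ?thesis
      by simp
  qed (simp add: erlang_density_def)
  then show "AE t in lebesgue. norm (erlang_density i l t * f t) \<le>
               norm (K * (erlang_density i l t * exp (A * t)))"
    by simp
qed

section \<open>Exponential test functions under the operator\<close>

lemma szasz_basis_nonneg: "x \<ge> 0 \<Longrightarrow> 0 \<le> szasz_basis n k x"
  by (simp add: szasz_basis_def)

lemma szasz_basis_tendsto_0:
  assumes "x > 0"
  shows "(\<lambda>n. szasz_basis n k x) \<longlonglongrightarrow> 0"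
proof -
  have "filterlim (\<lambda>n. real n * x) at_top sequentially"
    using assms
    by (intro filterlim_at_top_mult_tendsto_pos [OF tendsto_const _ filterlim_real_sequentially])
  then have "(\<lambda>n. (real n * x) ^ nat k / exp (real n * x)) \<longlonglongrightarrow> 0"
    by (rule filterlim_compose [OF tendsto_power_div_exp_0])
  then have "(\<lambda>n. (real n * x) ^ nat k / exp (real n * x) / fact (nat k)) \<longlonglongrightarrow> 0"
    by (intro tendsto_divide_zero)
  moreover have "(real n * x) ^ nat k / exp (real n * x) / fact (nat k) =
      (real n * x) ^ nat k / fact (nat k) * exp (- (real n * x))" for n
    by (simp add: exp_minus divide_simps)
  ultimately show ?thesis
    by (cases "k < 0") (simp_all add: szasz_basis_def)
qed

text \<open>
  The series is the generating function of a Poisson distribution with its first \<open>j\<close> terms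
  removed. With \<open>k = j + i\<close> the exponent \<open>i + 1\<close> is \<open>k + (1 - j)\<close>, which explains the integer
  power in front. For negative \<open>j\<close> nothing is removed: the series then starts with \<open>- j\<close> zeros.
\<close>

lemma szasz_basis_power_sums:
  assumes "r > 0"
  shows "(\<lambda>i. szasz_basis n (j + int i) x * r ^ Suc i) sums
           (r powi (1 - j) *
             (exp (real n * x * (r - 1)) - (\<Sum>k<nat j. szasz_basis n (int k) x * r ^ k)))"
proof -
  define g where "g k = szasz_basis n (int k) x * r ^ k" for k
  have "(\<lambda>k. exp (- (real n * x)) * (inverse (fact k) * (real n * x * r) ^ k)) sums
          (exp (- (real n * x)) * exp (real n * x * r))"
    using sums_mult [OF exp_converges [of "real n * x * r"]] by (simp add: divide_inverse)
  moreover have "exp (- (real n * x)) * (inverse (fact k) * (real n * x * r) ^ k) = g k" for k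
    by (simp add: g_def szasz_basis_def power_mult_distrib divide_inverse mult_ac)
  moreover have "exp (- (real n * x)) * exp (real n * x * r) = exp (real n * x * (r - 1))"
    by (simp add: exp_add [symmetric] algebra_simps)
  ultimately have "g sums exp (real n * x * (r - 1))"
    by simp
  then have tail: "(\<lambda>i. g (i + nat j)) sums (exp (real n * x * (r - 1)) - (\<Sum>k<nat j. g k))"
    by (simp add: sums_iff_shift)
  have pow: "r powi (1 - j) * r ^ k = r ^ Suc i" if "int k = j + int i" for i k
  proof -
    have "r powi (1 - j) * r ^ k = r powi (1 - j + int k)"
      using assms by (simp add: power_int_add)
    also have "1 - j + int k = int (Suc i)"
      using that by simp
    finally show ?thesis
      by (metis power_int_of_nat)
  qed
  \<comment> \<open>One of \<open>nat j\<close> and \<open>nat (- j)\<close> is \<open>0\<close>, so shifting the two series by these amounts aligns them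
    whatever the sign of \<open>j\<close>.\<close>
  have *: "(\<lambda>i. szasz_basis n (j + int (i + nat (- j))) x * r ^ Suc (i + nat (- j))) =
        (\<lambda>i. r powi (1 - j) * g (i + nat j))"
  proof
    fix i
    have "int (i + nat j) = j + int (i + nat (- j))"
      by auto
    then show "szasz_basis n (j + int (i + nat (- j))) x * r ^ Suc (i + nat (- j)) =
               r powi (1 - j) * g (i + nat j)"
      using pow [of "i + nat j" "i + nat (- j)"] by (simp only: g_def) (simp add: mult_ac)
  qed
  have "(\<lambda>i. szasz_basis n (j + int (i + nat (- j))) x * r ^ Suc (i + nat (- j))) sums
      (r powi (1 - j) * (exp (real n * x * (r - 1)) - (\<Sum>k<nat j. g k)))"
    unfolding * by (intro sums_mult tail)
  then show ?thesis
    by (subst (asm) sums_zero_iff_shift) (auto simp: szasz_basis_def g_def)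
qed

text \<open>The series part of the operator, applied to the test function \<open>exp (c * t)\<close>.\<close>

definition szasz_exp_sum :: "nat \<Rightarrow> int \<Rightarrow> real \<Rightarrow> real \<Rightarrow> real" where
  "szasz_exp_sum n j x c =
     (\<Sum>i. szasz_basis n (j + int i) x * (real n / (real n - c)) ^ Suc i)"

lemma szasz_exp_sum_sums:
  assumes "c < real n" "n > 0"
  shows "(\<lambda>i. szasz_basis n (j + int i) x * (real n / (real n - c)) ^ Suc i) sums
           szasz_exp_sum n j x c"
  unfolding szasz_exp_sum_def
  using szasz_basis_power_sums [of "real n / (real n - c)"] assms
  by (intro summable_sums sums_summable) auto

lemma szasz_exp_sum_tendsto:
  assumes "x > 0"
  shows "(\<lambda>n. szasz_exp_sum n j x c) \<longlonglongrightarrow> exp (c * x)"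
proof -
  define r where "r n = real n / (real n - c)" for n
  have large: "\<forall>\<^sub>F n in sequentially. c < real n \<and> n > 0"
    using eventually_gt_at_top [of "nat \<lceil>\<bar>c\<bar>\<rceil>"] by eventually_elim linarith
  have r: "r \<longlonglongrightarrow> 1"
    unfolding r_def by real_asymp
  have "(\<lambda>n. real n * (r n - 1)) \<longlonglongrightarrow> c"
    unfolding r_def by real_asymp
  then have "(\<lambda>n. real n * (r n - 1) * x) \<longlonglongrightarrow> c * x"
    by (intro tendsto_mult tendsto_const)
  then have e: "(\<lambda>n. exp (real n * x * (r n - 1))) \<longlonglongrightarrow> exp (c * x)"
    by (auto intro!: tendsto_exp simp: mult_ac)
  have "(\<lambda>n. r n powi (1 - j) *
          (exp (real n * x * (r n - 1)) - (\<Sum>k<nat j. szasz_basis n (int k) x * r n ^ k)))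
        \<longlonglongrightarrow> 1 powi (1 - j) * (exp (c * x) - (\<Sum>k<nat j. 0 * 1 ^ k))"
    by (intro tendsto_intros e r szasz_basis_tendsto_0 assms) auto
  moreover have "\<forall>\<^sub>F n in sequentially. r n powi (1 - j) *
          (exp (real n * x * (r n - 1)) - (\<Sum>k<nat j. szasz_basis n (int k) x * r n ^ k))
        = szasz_exp_sum n j x c"
    using large
  proof eventually_elim
    case (elim n)
    then have "r n > 0"
      by (simp add: r_def)
    from szasz_basis_power_sums [OF this] show ?case
      by (auto simp: szasz_exp_sum_def r_def sums_iff)
  qed
  ultimately show ?thesis
    by (auto intro: Lim_transform_eventually)
qed

section \<open>Transfer to functions of exponential growth\<close>

text \<open>
  Near \<open>x\<close> continuity suffices. For \<open>\<bar>t - x\<bar> \<ge> \<delta>\<close>, write \<open>u = exp (B * t)\<close> and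
  \<open>d = \<bar>u - v\<bar>\<close> with \<open>B = A + 1\<close>. As \<open>B \<ge> A\<close>, the deviation is at most
  \<open>K * (u + v) \<le> K * (d + 2 * v)\<close>. As \<open>B \<ge> 1\<close>, the map \<open>exp (B * t)\<close> has slope at least \<open>1\<close>, so
  \<open>d \<ge> \<delta>\<close>, and \<open>d + 2 * v\<close> is at most a multiple of \<open>d\<^sup>2\<close>.
\<close>

lemma deviation_le_exp_square:
  fixes f :: "real \<Rightarrow> real"
  assumes f: "continuous_on {0..} f" and "x \<ge> 0" "A \<ge> 0" "K \<ge> 0" "\<epsilon> > 0"
    and bound: "\<And>t. t \<ge> 0 \<Longrightarrow> \<bar>f t\<bar> \<le> K * exp (A * t)"
  obtains M where "M \<ge> 0"
    "\<And>t. t \<ge> 0 \<Longrightarrow> \<bar>f t - f x\<bar> \<le> \<epsilon> + M * (exp ((A + 1) * t) - exp ((A + 1) * x))\<^sup>2"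
proof -
  obtain \<delta> where \<delta>: "\<delta> > 0" "\<And>t. t \<ge> 0 \<Longrightarrow> \<bar>t - x\<bar> < \<delta> \<Longrightarrow> \<bar>f t - f x\<bar> < \<epsilon>"
    using f \<open>x \<ge> 0\<close> \<open>\<epsilon> > 0\<close> unfolding continuous_on_iff by (force simp: dist_real_def)
  define v where "v = exp ((A + 1) * x)"
  define M where "M = K * (1 / \<delta> + 2 * v / \<delta>\<^sup>2)"
  have growth: "s - t \<le> exp ((A + 1) * s) - exp ((A + 1) * t)" if "0 \<le> t" "t \<le> s" for s t
  proof -
    have "1 + (A + 1) * (s - t) \<le> exp ((A + 1) * (s - t))"
      by (rule exp_ge_add_one_self)
    then have "s - t \<le> 1 * (exp ((A + 1) * (s - t)) - 1)"
      using that \<open>A \<ge> 0\<close> mult_nonneg_nonneg [of A "s - t"] by (simp add: algebra_simps)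
    also have "\<dots> \<le> exp ((A + 1) * t) * (exp ((A + 1) * (s - t)) - 1)"
      using that \<open>A \<ge> 0\<close> by (intro mult_right_mono) auto
    finally show ?thesis
      by (simp add: algebra_simps exp_add [symmetric])
  qed
  have M: "M \<ge> 0"
    using assms \<delta> by (simp add: M_def v_def)
  have "\<bar>f t - f x\<bar> \<le> \<epsilon> + M * (exp ((A + 1) * t) - v)\<^sup>2" if "t \<ge> 0" for t
  proof (cases "\<bar>t - x\<bar> < \<delta>")
    case True
    then have "\<bar>f t - f x\<bar> \<le> \<epsilon>"
      using \<delta> that by (simp add: less_imp_le)
    then show ?thesis
      using M by (simp add: add_increasing2)
  next
    case False
    define u where "u = exp ((A + 1) * t)"
    define d where "d = \<bar>u - v\<bar>"
    have d: "\<delta> \<le> d"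
      using growth [of t x] growth [of x t] that \<open>x \<ge> 0\<close> False
      unfolding d_def u_def v_def by linarith
    have "v > 0"
      by (simp add: v_def)
    have "\<bar>f t - f x\<bar> \<le> K * exp (A * t) + K * exp (A * x)"
      using bound [OF that] bound [OF \<open>x \<ge> 0\<close>] by linarith
    also have "\<dots> \<le> K * u + K * v"
      using assms that by (intro add_mono mult_left_mono) (auto simp: u_def v_def algebra_simps)
    also have "\<dots> \<le> K * (d * 1 + 2 * v * 1)"
      using assms by (auto simp: d_def distrib_left [symmetric] intro!: mult_left_mono)
    \<comment> \<open>The first unit factor is enlarged to \<open>d / \<delta>\<close>, the second to its square.\<close>
    also have "\<dots> \<le> K * (d * (d / \<delta>) + 2 * v * (d / \<delta>)\<^sup>2)"
      using assms d \<delta> \<open>v > 0\<close>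
      by (intro mult_left_mono add_mono) (auto simp: one_le_power)
    also have "\<dots> = M * (u - v)\<^sup>2"
      using \<delta> by (simp add: M_def d_def power2_eq_square field_simps)
    finally show ?thesis
      using \<open>\<epsilon> > 0\<close> by (simp add: u_def)
  qed
  with M that show thesis
    by (simp add: v_def)
qed

text \<open>
  Monotonicity of the integral against a probability density; the bracket is the mean of
  \<open>(exp (B * t) - v)\<^sup>2\<close>, expanded into exponential moments.
\<close>

lemma erlang_mean_deviation:
  assumes f: "continuous_on {0..} f" and bound: "\<And>t. t \<ge> 0 \<Longrightarrow> \<bar>f t\<bar> \<le> K * exp (A * t)"
    and dev: "\<And>t. t \<ge> 0 \<Longrightarrow> \<bar>f t - y\<bar> \<le> \<epsilon> + M * (exp (B * t) - v)\<^sup>2"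
    and l: "A < l" "B < l" "2 * B < l" "0 < l"
  shows "\<bar>erlang_mean i l f - y\<bar> \<le>
           \<epsilon> + M * ((l / (l - 2 * B)) ^ Suc i - 2 * v * (l / (l - B)) ^ Suc i + v\<^sup>2)"
proof -
  let ?w = "erlang_density i l"
  have one: "has_bochner_integral lebesgue ?w 1"
    using erlang_exp_moment [of 0 l i] l by simp
  have f1: "has_bochner_integral lebesgue (\<lambda>t. ?w t * f t - y * ?w t) (erlang_mean i l f - y * 1)"
    unfolding erlang_mean_def
    by (intro has_bochner_integral_diff has_bochner_integral_mult_right one
        has_bochner_integral_integrable integrable_erlang_times [OF f bound]) (use l in auto)
  have g: "has_bochner_integral lebesgue
       (\<lambda>t. \<epsilon> * ?w t + M * (?w t * exp (2 * B * t) - 2 * v * (?w t * exp (B * t)) + v\<^sup>2 * ?w t))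
       (\<epsilon> * 1 + M * ((l / (l - 2 * B)) ^ Suc i - 2 * v * (l / (l - B)) ^ Suc i + v\<^sup>2 * 1))"
    by (intro has_bochner_integral_add has_bochner_integral_diff has_bochner_integral_mult_right
        one erlang_exp_moment l)
  have "\<bar>?w t * f t - y * ?w t\<bar> \<le>
      \<epsilon> * ?w t + M * (?w t * exp (2 * B * t) - 2 * v * (?w t * exp (B * t)) + v\<^sup>2 * ?w t)" for t
  proof (cases "t < 0")
    case False
    have "exp (2 * B * t) = (exp (B * t))\<^sup>2"
      by (simp add: power2_eq_square exp_add [symmetric])
    then have "\<epsilon> * ?w t + M * (?w t * exp (2 * B * t) - 2 * v * (?w t * exp (B * t)) + v\<^sup>2 * ?w t)
        = ?w t * (\<epsilon> + M * (exp (B * t) - v)\<^sup>2)"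
      by (simp add: power2_eq_square algebra_simps)
    moreover have "\<bar>?w t * f t - y * ?w t\<bar> = ?w t * \<bar>f t - y\<bar>"
    proof -
      have "?w t * f t - y * ?w t = ?w t * (f t - y)"
        by (simp add: algebra_simps)
      then show ?thesis
        using l by (simp add: abs_mult)
    qed
    ultimately show ?thesis
      using dev [of t] False l by (auto intro: mult_left_mono)
  qed (simp add: erlang_density_def)
  then have "norm (\<integral>t. ?w t * f t - y * ?w t \<partial>lebesgue) \<le>
     (\<integral>t. \<epsilon> * ?w t + M * (?w t * exp (2 * B * t) - 2 * v * (?w t * exp (B * t)) + v\<^sup>2 * ?w t) \<partial>lebesgue)"
    by (intro Bochner_Integration.integral_norm_bound_integral
        integrable.intros [OF f1] integrable.intros [OF g]) simp
  then show ?thesis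
    using f1 g by (simp add: has_bochner_integral_iff)
qed

text \<open>
  The previous estimate mixed with the weights \<open>szasz_basis n (j + i) x\<close>. Their total mass
  \<open>szasz_exp_sum n j x 0\<close> is less than \<open>1\<close> when \<open>j > 0\<close> and \<open>n * x > 0\<close>, so \<open>y\<close> has to be
  multiplied by it.
\<close>

lemma suminf_erlang_mean_deviation:
  assumes f: "continuous_on {0..} f" and bound: "\<And>t. t \<ge> 0 \<Longrightarrow> \<bar>f t\<bar> \<le> K * exp (A * t)"
    and dev: "\<And>t. t \<ge> 0 \<Longrightarrow> \<bar>f t - y\<bar> \<le> \<epsilon> + M * (exp (B * t) - v)\<^sup>2"
    and n: "A < real n" "B < real n" "2 * B < real n" "0 < n" and "x \<ge> 0"
  shows "\<bar>(\<Sum>i. szasz_basis n (j + int i) x * erlang_mean i (real n) f)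
             - y * szasz_exp_sum n j x 0\<bar> \<le>
           \<epsilon> * szasz_exp_sum n j x 0 + M * (szasz_exp_sum n j x (2 * B)
             - 2 * v * szasz_exp_sum n j x B + v\<^sup>2 * szasz_exp_sum n j x 0)"
proof -
  let ?s = "\<lambda>i. szasz_basis n (j + int i) x"
  let ?\<rho> = "\<lambda>c i. (real n / (real n - c)) ^ Suc i"
  let ?b = "\<lambda>i. \<epsilon> * (?s i * ?\<rho> 0 i) + M * (?s i * ?\<rho> (2 * B) i
     - 2 * v * (?s i * ?\<rho> B i) + v\<^sup>2 * (?s i * ?\<rho> 0 i))"
  let ?d = "\<lambda>i. ?s i * erlang_mean i (real n) f - y * (?s i * ?\<rho> 0 i)"
  have b: "?b sums (\<epsilon> * szasz_exp_sum n j x 0 + M * (szasz_exp_sum n j x (2 * B)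
             - 2 * v * szasz_exp_sum n j x B + v\<^sup>2 * szasz_exp_sum n j x 0))"
    by (intro sums_add sums_diff sums_mult szasz_exp_sum_sums) (use n in auto)
  have le: "\<bar>?d i\<bar> \<le> ?b i" for i
  proof -
    have "\<bar>?d i\<bar> = ?s i * \<bar>erlang_mean i (real n) f - y\<bar>"
    proof -
      have "?d i = ?s i * (erlang_mean i (real n) f - y)"
        using n by (simp add: algebra_simps)
      then show ?thesis
        using szasz_basis_nonneg [OF \<open>x \<ge> 0\<close>] by (simp add: abs_mult)
    qed
    also have "\<dots> \<le> ?s i * (\<epsilon> + M * (?\<rho> (2 * B) i - 2 * v * ?\<rho> B i + v\<^sup>2))"
      using n by (intro mult_left_mono erlang_mean_deviation [OF f bound dev]
          szasz_basis_nonneg \<open>x \<ge> 0\<close>) auto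
    also have "\<dots> = ?b i"
      using n by (simp add: algebra_simps)
    finally show ?thesis .
  qed
  have d: "summable ?d"
    by (rule summable_comparison_test' [OF sums_summable [OF b], of 0]) (use le in simp)
  have "(\<lambda>i. y * (?s i * ?\<rho> 0 i)) sums (y * szasz_exp_sum n j x 0)"
    by (intro sums_mult szasz_exp_sum_sums) (use n in auto)
  from sums_add [OF summable_sums [OF d] this]
  have "suminf ?d = (\<Sum>i. ?s i * erlang_mean i (real n) f) - y * szasz_exp_sum n j x 0"
    by (simp add: sums_iff)
  moreover have "\<bar>suminf ?d\<bar> \<le> suminf ?b"
    using norm_suminf_le [of ?d ?b, OF _ sums_summable [OF b]] le by simp
  ultimately show ?thesis
    using b by (simp add: sums_iff)
qed

theorem corollary13:
  fixes j :: int and x :: real and f :: "real \<Rightarrow> real"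
  assumes "x > 0" and "f \<in> E_space \<inter> C_space"
  shows "(\<lambda>n. szasz_durrmeyer n j f x) \<longlonglongrightarrow> f x"
proof -
  from assms obtain A K where AK: "A \<ge> 0" "K > 0"
    and bound: "\<And>t. t \<ge> 0 \<Longrightarrow> \<bar>f t\<bar> \<le> K * exp (A * t)"
    by (auto simp: E_space_def E_exp_def)
  from assms have f: "continuous_on {0..} f"
    by (simp add: C_space_def)
  define B where "B = A + 1"
  define v where "v = exp (B * x)"
  let ?S = "\<lambda>n c. szasz_exp_sum n j x c"
  let ?head = "\<lambda>n. f 0 * (\<Sum>k\<in>{0..j - 1}. szasz_basis n k x)"
  show ?thesis
  proof (rule LIMSEQ_I)
    fix e :: real
    assume "e > 0"
    then have "e / 2 > 0"
      by simp
    then obtain M where M: "M \<ge> 0"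
        "\<And>t. t \<ge> 0 \<Longrightarrow> \<bar>f t - f x\<bar> \<le> e / 2 + M * (exp (B * t) - v)\<^sup>2"
      using deviation_le_exp_square [OF f _ _ _ _ bound, of x "e / 2"] AK \<open>x > 0\<close>
      unfolding B_def v_def by (metis less_imp_le)
    \<comment> \<open>\<open>?R n\<close> bounds the error by the boundary term, the missing mass of the weights, and the
      Korovkin estimate.\<close>
    let ?R = "\<lambda>n. \<bar>?head n\<bar> + \<bar>f x * (?S n 0 - 1)\<bar> + (e / 2 * ?S n 0
              + M * (?S n (2 * B) - 2 * v * ?S n B + v\<^sup>2 * ?S n 0))"
    have "?R \<longlonglongrightarrow> \<bar>f 0 * (\<Sum>k\<in>{0..j - 1}. 0)\<bar> + \<bar>f x * (exp (0 * x) - 1)\<bar>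
       + (e / 2 * exp (0 * x) + M * (exp (2 * B * x) - 2 * v * exp (B * x) + v\<^sup>2 * exp (0 * x)))"
      by (intro tendsto_intros szasz_basis_tendsto_0 szasz_exp_sum_tendsto \<open>x > 0\<close>)
    also have "exp (2 * B * x) - 2 * v * exp (B * x) + v\<^sup>2 * exp (0 * x) = 0"
      using exp_double [of "B * x"] by (simp add: v_def power2_eq_square mult.assoc)
    finally have "?R \<longlonglongrightarrow> e / 2"
      by simp
    from order_tendstoD(2) [OF this, of e]
    have "\<forall>\<^sub>F n in sequentially. ?R n < e"
      using \<open>e > 0\<close> by simp
    moreover have "\<forall>\<^sub>F n in sequentially. 2 * B < real n"
      by real_asymp
    ultimately have "\<forall>\<^sub>F n in sequentially. norm (szasz_durrmeyer n j f x - f x) < e"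
    proof eventually_elim
      case (elim n)
      then have n: "A < real n" "B < real n" "2 * B < real n" "0 < n"
        using AK by (auto simp: B_def intro: Nat.gr0I)
      have "\<bar>(\<Sum>i. szasz_basis n (j + int i) x * erlang_mean i (real n) f) - f x * ?S n 0\<bar>
          \<le> e / 2 * ?S n 0 + M * (?S n (2 * B) - 2 * v * ?S n B + v\<^sup>2 * ?S n 0)"
        using \<open>x > 0\<close> by (intro suminf_erlang_mean_deviation [OF f bound M(2)] n) auto
      then show ?case
        using elim(1) unfolding szasz_durrmeyer_eq_erlang_mean [OF n(4)]
        by (simp only: real_norm_def right_diff_distrib mult_1_right)
    qed
    then show "\<exists>N. \<forall>n\<ge>N. norm (szasz_durrmeyer n j f x - f x) < e"
      by (simp add: eventually_sequentially)
  qed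
qed

end
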